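(* Let $D$ be an oriented multigraph with $m$ arcs and maximum degree $\Delta(D)\le 5$. Then $\mathrm{fas}(D)\le m/3$.
   Context: All digraphs are finite. An oriented multigraph is a directed multigraph (parallel arcs allowed) without loops and without directed cycles of length 2; arcs are counted with multiplicity. The degree $d_D(v)$ of a vertex $v$ is the number of arcs incident with $v$ (the sum of its out-degree and in-degree, counted with multiplicity), and $\Delta(D)$ is the maximum degree of a vertex of $D$. A set $F$ of arcs of $D$ is a feedback arc set if $D-F$ has no directed cycle; $\mathrm{fas}(D)$ is the minimum number of arcs in a feedback arc set of $D$. *)

theory Defs
  imports Complex_Main "Graph_Theory.Arc_Walk"
begin

text \<open>
  Arcs of a \<^typ>\<open>('a, 'b) pre_digraph\<close> are elements of a type of their own, so parallel
  arcs are distinct members of \<^term>\<open>arcs D\<close> and cardinalities count multiplicity.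
\<close>

locale oriented_multigraph = fin_digraph + loopfree_digraph +
  assumes no_2_cycles: "cycle p \<Longrightarrow> length p \<noteq> 2"

definition degree :: "('a, 'b) pre_digraph \<Rightarrow> 'a \<Rightarrow> nat" where
  "degree D v = out_degree D v + in_degree D v"

text \<open>The inserted 0 only gives the digraph without vertices the maximum degree 0.\<close>

definition max_degree :: "('a, 'b) pre_digraph \<Rightarrow> nat" where
  "max_degree D = Max (insert 0 (degree D ` verts D))"

definition del_arcs :: "('a, 'b) pre_digraph \<Rightarrow> 'b set \<Rightarrow> ('a, 'b) pre_digraph" where
  "del_arcs D F = D\<lparr>arcs := arcs D - F\<rparr>"

definition feedback_arc_set :: "('a, 'b) pre_digraph \<Rightarrow> 'b set \<Rightarrow> bool" where
  "feedback_arc_set D F \<longleftrightarrow> F \<subseteq> arcs D \<and> (\<nexists>p. pre_digraph.cycle (del_arcs D F) p)"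

text \<open>
  For finite \<^term>\<open>D\<close> the minimum is over a finite nonempty set,
  see \<open>fas_attained\<close> and \<open>fas_le\<close> below.
\<close>

definition fas :: "('a, 'b) pre_digraph \<Rightarrow> nat" where
  "fas D = Min (card ` {F. feedback_arc_set D F})"

lemma (in fin_digraph) finite_feedback_arc_sets: "finite {F. feedback_arc_set G F}"
  by (rule finite_subset[of _ "Pow (arcs G)"]) (auto simp: feedback_arc_set_def)

lemma feedback_arc_set_arcs: "feedback_arc_set D (arcs D)"
  by (auto simp: feedback_arc_set_def del_arcs_def pre_digraph.cycle_def pre_digraph.awalk_def)

lemma (in fin_digraph) fas_attained: "\<exists>F. feedback_arc_set G F \<and> card F = fas G"
proof -
  have "fas G \<in> card ` {F. feedback_arc_set G F}"
    unfolding fas_def using finite_feedback_arc_sets feedback_arc_set_arcs[of G]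
    by (intro Min_in) auto
  then show ?thesis by auto
qed

lemma (in fin_digraph) fas_le: "feedback_arc_set G F \<Longrightarrow> fas G \<le> card F"
  unfolding fas_def using finite_feedback_arc_sets by (intro Min_le) auto

lemma (in fin_digraph) max_degree_le_iff:
  "max_degree G \<le> k \<longleftrightarrow> (\<forall>v\<in>verts G. degree G v \<le> k)"
  by (simp add: max_degree_def)

lemma (in oriented_multigraph) no_opposite_arcs:
  assumes "e \<in> arcs G" "e' \<in> arcs G" "head G e = tail G e'"
  shows "head G e' \<noteq> tail G e"
proof
  assume "head G e' = tail G e"
  then have "cycle [e, e']"
    using assms no_loops[of e] by (auto simp: cycle_def awalk_def intro!: exI[of _ "tail G e"])
  then show False using no_2_cycles by fastforce
qed

end

theory Submission
  imports Defs
begin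

text \<open>
  Opposite arcs between two vertices cost exactly one backward arc in every ordering, so only the
  net number \<open>t u v = - t v u\<close> of arcs matters. Three times the number of backward arcs minus the
  number of arcs is a sum of penalties over the pairs \<open>u\<close> before \<open>v\<close>, and some ordering must make
  it nonpositive. In a counterexample with as few vertices as possible, no sequence of the
  following reductions has nonpositive total cost: putting a vertex first (cost twice in-degree
  minus out-degree) or last, and merging the ends of an arc, where opposite arcs created by the merger cancel.
  This forces (out-degree, in-degree) to be (3,2), (2,3) or (2,2) at every vertex. A (3,2)-vertex
  has an in-neighbour of type (2,2), and the arcs around this in-neighbour always
  admit a reduction; (2,3) is dual. If all vertices are of type (2,2), merging excludes
  directed triangles and removals exclude transitive ones; then one can remove a vertex and merge
  two of its out-neighbours into neighbours of theirs.
\<close>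

section \<open>Orderings of antisymmetric arc weights\<close>

text \<open>
  A pair with net number \<open>a\<close> of forward arcs contributes 3 times its backward arcs minus its arcs.
\<close>

definition penalty :: "int \<Rightarrow> int" where
  "penalty a = (if a \<ge> 0 then - a else - 2 * a)"

text \<open>The number of pairs of opposite arcs when \<open>a\<close> and \<open>b\<close> arcs are combined.\<close>

definition overlap :: "int \<Rightarrow> int \<Rightarrow> int" where
  "overlap a b = penalty a + penalty b - penalty (a + b)"

definition excess :: "'a set \<Rightarrow> ('a \<Rightarrow> 'a \<Rightarrow> int) \<Rightarrow> ('a \<Rightarrow> int) \<Rightarrow> int" where
  "excess V t r = (\<Sum>u\<in>V. \<Sum>v\<in>V. if r u < r v then penalty (t u v) else 0)"

definition orderable :: "'a set \<Rightarrow> ('a \<Rightarrow> 'a \<Rightarrow> int) \<Rightarrow> int \<Rightarrow> bool" where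
  "orderable V t k \<longleftrightarrow> (\<exists>r. inj_on r V \<and> excess V t r \<le> k)"

definition first_cost :: "'a set \<Rightarrow> ('a \<Rightarrow> 'a \<Rightarrow> int) \<Rightarrow> 'a \<Rightarrow> int" where
  "first_cost V t v = (\<Sum>u\<in>V. penalty (t v u))"

definition last_cost :: "'a set \<Rightarrow> ('a \<Rightarrow> 'a \<Rightarrow> int) \<Rightarrow> 'a \<Rightarrow> int" where
  "last_cost V t v = (\<Sum>u\<in>V. penalty (t u v))"

definition tdeg :: "'a set \<Rightarrow> ('a \<Rightarrow> 'a \<Rightarrow> int) \<Rightarrow> 'a \<Rightarrow> int" where
  "tdeg V t v = (\<Sum>u\<in>V. \<bar>t v u\<bar>)"

definition merge_overlap :: "'a set \<Rightarrow> ('a \<Rightarrow> 'a \<Rightarrow> int) \<Rightarrow> 'a \<Rightarrow> 'a \<Rightarrow> int" where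
  "merge_overlap V t p q = (\<Sum>x\<in>V. overlap (t p x) (t q x))"

text \<open>Merges \<open>q\<close> into \<open>p\<close>; only meaningful on vertex sets without \<open>q\<close>.\<close>

definition merge :: "('a \<Rightarrow> 'a \<Rightarrow> int) \<Rightarrow> 'a \<Rightarrow> 'a \<Rightarrow> 'a \<Rightarrow> 'a \<Rightarrow> int" where
  "merge t p q x y =
     (if x = p \<and> y = p then 0
      else if x = p then t p y + t q y
      else if y = p then t x p + t x q
      else t x y)"

section \<open>Arithmetic of penalties and overlaps\<close>

lemma penalty_0 [simp]: "penalty 0 = 0"
  and penalty_1 [simp]: "penalty 1 = - 1"
  and penalty_m1 [simp]: "penalty (- 1) = 2"
  by (simp_all add: penalty_def)

lemma overlap_0 [simp]: "overlap a 0 = 0" "overlap 0 a = 0"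
  by (simp_all add: overlap_def)

lemma overlap_nonneg: "overlap a b \<ge> 0"
  and overlap_le: "overlap a b \<le> \<bar>b\<bar>"
  and overlap_double: "2 * overlap a b = \<bar>a\<bar> + \<bar>b\<bar> - \<bar>a + b\<bar>"
  and overlap_uminus: "overlap (- a) (- b) = overlap a b"
  and overlap_right_1: "overlap a 1 = (if a < 0 then 1 else 0)"
  and overlap_right_m1: "overlap a (- 1) = (if a > 0 then 1 else 0)"
  by (auto simp: overlap_def penalty_def)

lemma merge_overlap_nonneg: "merge_overlap V t p q \<ge> 0"
  unfolding merge_overlap_def by (intro sum_nonneg overlap_nonneg)

lemma excess_insert:
  assumes "finite U" "a \<notin> U" "inj_on r (insert a U)"
  shows "excess (insert a U) t r =
    excess U t r + (\<Sum>v\<in>U. if r a < r v then penalty (t a v) else penalty (t v a))"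
proof -
  have ne: "r a \<noteq> r v" if "v \<in> U" for v
    using assms that by (auto simp: inj_on_def)
  have "excess (insert a U) t r = excess U t r
      + (\<Sum>v\<in>U. if r a < r v then penalty (t a v) else 0)
      + (\<Sum>v\<in>U. if r v < r a then penalty (t v a) else 0)"
    using assms by (simp add: excess_def sum.distrib)
  also have "(\<Sum>v\<in>U. if r v < r a then penalty (t v a) else 0) =
      (\<Sum>v\<in>U. if r a < r v then 0 else penalty (t v a))"
  proof (intro sum.cong refl)
    fix x assume "x \<in> U"
    with ne[of x] show "(if r x < r a then penalty (t x a) else 0) =
        (if r a < r x then 0 else penalty (t x a))" by auto
  qed
  finally show ?thesis
    by (simp add: add.assoc flip: sum.distrib) (auto intro!: sum.cong)
qed

lemma excess_cong:
  assumes "\<And>u v. u \<in> V \<Longrightarrow> v \<in> V \<Longrightarrow> t u v = s u v"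
    and "\<And>u v. u \<in> V \<Longrightarrow> v \<in> V \<Longrightarrow> r u < r v \<longleftrightarrow> q u < q v"
  shows "excess V t r = excess V s q"
  unfolding excess_def using assms by (intro sum.cong) auto

lemma orderable_mono: "orderable V t k \<Longrightarrow> k \<le> k' \<Longrightarrow> orderable V t k'"
  unfolding orderable_def by force

section \<open>The reductions: placing a vertex at an end and merging two vertices\<close>

lemma orderable_place_first:
  assumes "finite V" "v \<in> V" "\<And>x. t x x = 0" "orderable (V - {v}) t k"
  shows "orderable V t (k + first_cost V t v)"
proof -
  from assms obtain r where r: "inj_on r (V - {v})" "excess (V - {v}) t r \<le> k"
    by (auto simp: orderable_def)
  \<comment> \<open>Ranks are integers, so there is always room below all of them.\<close>
  define b where "b = Min (insert 0 (r ` V)) - 1"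
  have b: "b < r x" if "x \<in> V" for x
  proof -
    have "Min (insert 0 (r ` V)) \<le> r x"
      using that assms(1) by (intro Min_le) auto
    then show ?thesis by (simp add: b_def)
  qed
  let ?r = "r(v := b)"
  have inj: "inj_on ?r (insert v (V - {v}))"
    using r b by (force simp: inj_on_def)
  have "excess V t ?r = excess (insert v (V - {v})) t ?r"
    using assms by (simp add: insert_absorb)
  also have "\<dots> = excess (V - {v}) t ?r + (\<Sum>x\<in>V - {v}. penalty (t v x))"
    using assms inj b by (subst excess_insert) (auto intro!: sum.cong)
  also have "excess (V - {v}) t ?r = excess (V - {v}) t r"
    by (rule excess_cong) auto
  also have "(\<Sum>x\<in>V - {v}. penalty (t v x)) = first_cost V t v"
    using assms by (simp add: first_cost_def sum.remove)
  finally show ?thesis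
    using r inj assms(2) unfolding orderable_def
    by (intro exI[of _ ?r]) (simp add: insert_absorb del: fun_upd_apply)
qed

text \<open>Reversing all arcs together with the ordering keeps every penalty. Statements about last
  places and \<open>in_heavy\<close> vertices thus follow from their duals.\<close>

lemma orderable_transpose:
  assumes "orderable V t k"
  shows "orderable V (\<lambda>x y. t y x) k"
proof -
  from assms obtain r where r: "inj_on r V" "excess V t r \<le> k"
    by (auto simp: orderable_def)
  have "excess V (\<lambda>x y. t y x) (\<lambda>x. - r x) = excess V t r"
    unfolding excess_def by (subst sum.swap) (auto intro!: sum.cong)
  then show ?thesis
    using r unfolding orderable_def by (auto intro!: exI[of _ "\<lambda>x. - r x"] simp: inj_on_def)
qed

lemma orderable_place_last:
  assumes "finite V" "v \<in> V" "\<And>x. t x x = 0" "orderable (V - {v}) t k"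
  shows "orderable V t (k + last_cost V t v)"
proof -
  have "orderable V (\<lambda>x y. t y x) (k + first_cost V (\<lambda>x y. t y x) v)"
    using assms orderable_transpose[OF assms(4)] by (intro orderable_place_first) auto
  from orderable_transpose[OF this] show ?thesis
    by (simp add: first_cost_def last_cost_def)
qed

text \<open>In an ordering of the merged weights, \<open>p\<close> is replaced by \<open>p\<close>
  immediately followed by \<open>q\<close>. Every other vertex has both on the same side, so the two
  penalties exceed the merged one by exactly the overlap.\<close>

lemma orderable_merge:
  assumes fin: "finite V" and pq: "p \<in> V" "q \<in> V" "p \<noteq> q"
    and anti: "\<And>x y. t x y = - t y x"
    and ord: "orderable (V - {q}) (merge t p q) k"
  shows "orderable V t (k + penalty (t p q) + merge_overlap V t p q)"
proof -
  from ord obtain r where r: "inj_on r (V - {q})" "excess (V - {q}) (merge t p q) r \<le> k"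
    by (auto simp: orderable_def)
  define W where "W = V - {p, q}"
  have W: "finite W" "p \<notin> W" "q \<notin> insert p W" "V = insert q (insert p W)" "V - {q} = insert p W"
    using fin pq by (auto simp: W_def)
  \<comment> \<open>Doubling the ranks frees the odd value right after \<open>p\<close> for
    \<open>q\<close>.\<close>
  define r' where "r' x = (if x = q then 2 * r p + 1 else 2 * r x)" for x
  have ne: "r x \<noteq> r p" if "x \<in> W" for x
    using that inj_onD[OF r(1), of x p] W(2,5) by blast
  have odd: "2 * a \<noteq> 2 * b + 1" "2 * b + 1 \<noteq> 2 * a" for a b :: int
    by presburger+
  have inj: "inj_on r' V"
    using r(1) odd by (auto simp: inj_on_def r'_def)
  have inj': "inj_on r' (insert p W)"
    using inj by (rule inj_on_subset) (use W(4) in blast)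
  have t0: "t x x = 0" for x
    using anti[of x x] by linarith
  have "excess V t r' = excess (insert p W) t r' +
      (\<Sum>v\<in>insert p W. if r' q < r' v then penalty (t q v) else penalty (t v q))"
    using excess_insert[of "insert p W" q r' t] inj W(1,3) by (simp only: W(4) finite_insert simp_thms)
  also have "excess (insert p W) t r' = excess W t r' +
      (\<Sum>v\<in>W. if r' p < r' v then penalty (t p v) else penalty (t v p))"
    using W(1,2) inj' by (rule excess_insert)
  also have "excess W t r' = excess W t r"
    using W(3) by (intro excess_cong) (auto simp: r'_def)
  also have "(\<Sum>v\<in>W. if r' p < r' v then penalty (t p v) else penalty (t v p)) =
      (\<Sum>v\<in>W. if r p < r v then penalty (t p v) else penalty (t v p))"
    using W(3) pq(3) by (intro sum.cong) (auto simp: r'_def)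
  also have "(\<Sum>v\<in>insert p W. if r' q < r' v then penalty (t q v) else penalty (t v q)) =
      penalty (t p q) + (\<Sum>v\<in>W. if r' q < r' v then penalty (t q v) else penalty (t v q))"
    using W(1,2) pq(3) by (subst sum.insert) (auto simp: r'_def)
  also have "(\<Sum>v\<in>W. if r' q < r' v then penalty (t q v) else penalty (t v q)) =
      (\<Sum>v\<in>W. if r p < r v then penalty (t q v) else penalty (t v q))"
  proof (intro sum.cong refl)
    fix v assume "v \<in> W"
    with W(3) have "r' q < r' v \<longleftrightarrow> r p < r v"
      using ne[of v] by (auto simp: r'_def)
    then show "(if r' q < r' v then penalty (t q v) else penalty (t v q)) =
      (if r p < r v then penalty (t q v) else penalty (t v q))" by simp
  qed
  finally have e1: "excess V t r' = excess W t r
      + (\<Sum>v\<in>W. if r p < r v then penalty (t p v) else penalty (t v p))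
      + (penalty (t p q) + (\<Sum>v\<in>W. if r p < r v then penalty (t q v) else penalty (t v q)))" .
  have "excess (V - {q}) (merge t p q) r = excess W (merge t p q) r +
      (\<Sum>v\<in>W. if r p < r v then penalty (merge t p q p v) else penalty (merge t p q v p))"
    using excess_insert[of W p r "merge t p q"] r(1) W(1,2) by (simp only: W(5) simp_thms)
  also have "excess W (merge t p q) r = excess W t r"
    using W(2) by (intro excess_cong) (auto simp: merge_def)
  finally have e2: "excess (V - {q}) (merge t p q) r = excess W t r +
      (\<Sum>v\<in>W. if r p < r v then penalty (merge t p q p v) else penalty (merge t p q v p))" .
  have "merge_overlap V t p q = (\<Sum>v\<in>W. overlap (t p v) (t q v))"
    using W pq t0 by (simp add: merge_overlap_def)
  also have "\<dots> = (\<Sum>v\<in>W. if r p < r v then penalty (t p v) else penalty (t v p))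
      + (\<Sum>v\<in>W. if r p < r v then penalty (t q v) else penalty (t v q))
      - (\<Sum>v\<in>W. if r p < r v then penalty (merge t p q p v) else penalty (merge t p q v p))"
    unfolding sum.distrib[symmetric] sum_subtractf[symmetric]
  proof (intro sum.cong refl)
    fix v assume v: "v \<in> W"
    have "overlap (t p v) (t q v) = overlap (t v p) (t v q)"
      using overlap_uminus[of "t v p" "t v q"] anti[of p v] anti[of q v] by simp
    with v W(2) show "overlap (t p v) (t q v) =
       (if r p < r v then penalty (t p v) else penalty (t v p)) +
       (if r p < r v then penalty (t q v) else penalty (t v q)) -
       (if r p < r v then penalty (merge t p q p v) else penalty (merge t p q v p))"
      by (auto simp: merge_def overlap_def)
  qed
  finally have "excess V t r' \<le> k + penalty (t p q) + merge_overlap V t p q"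
    using e1 e2 r(2) by linarith
  then show ?thesis
    using inj unfolding orderable_def by blast
qed

lemma merge_antisym:
  assumes "\<And>x y. t x y = - t y x"
  shows "merge t p q x y = - merge t p q y x"
proof -
  have "t p y = - t y p" "t q y = - t y q" "t p x = - t x p" "t q x = - t x q" "t x y = - t y x"
    by (rule assms)+
  then show ?thesis
    unfolding merge_def by (smt (verit))
qed

section \<open>Degrees and overlaps under merging and removal\<close>

text \<open>Arcs between \<open>p\<close> and \<open>q\<close> vanish at both ends, and each unit of
  overlap cancels two arcs. Overlap thus raises the cost of a merger but helps to keep the degree
  bound.\<close>

lemma tdeg_merge:
  assumes fin: "finite V" and pq: "p \<in> V" "q \<in> V" "p \<noteq> q"
    and anti: "\<And>x y. t x y = - t y x"
  shows "tdeg (V - {q}) (merge t p q) p =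
    tdeg V t p + tdeg V t q - 2 * \<bar>t p q\<bar> - 2 * merge_overlap V t p q"
proof -
  define W where "W = V - {p, q}"
  have W: "finite W" "p \<notin> W" "q \<notin> insert p W" "V = insert q (insert p W)" "V - {q} = insert p W"
    using fin pq by (auto simp: W_def)
  have t0: "t x x = 0" for x
    using anti[of x x] by linarith
  have "tdeg (V - {q}) (merge t p q) p = (\<Sum>x\<in>W. \<bar>t p x + t q x\<bar>)"
    unfolding tdeg_def W(5) using W by (auto simp: merge_def intro!: sum.cong)
  moreover have "2 * merge_overlap V t p q =
      (\<Sum>x\<in>W. \<bar>t p x\<bar>) + (\<Sum>x\<in>W. \<bar>t q x\<bar>) - (\<Sum>x\<in>W. \<bar>t p x + t q x\<bar>)"
    using W pq t0
    by (simp add: merge_overlap_def sum_distrib_left overlap_double sum.distrib sum_subtractf)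
  moreover have "tdeg V t p = \<bar>t p q\<bar> + (\<Sum>x\<in>W. \<bar>t p x\<bar>)"
    "tdeg V t q = \<bar>t q p\<bar> + (\<Sum>x\<in>W. \<bar>t q x\<bar>)"
    using W pq t0 by (simp_all add: tdeg_def)
  ultimately show ?thesis
    using anti[of q p] by simp
qed

lemma tdeg_merge_other:
  assumes fin: "finite V" and pq: "p \<in> V" "q \<in> V" "p \<noteq> q" and x: "x \<noteq> p"
  shows "tdeg (V - {q}) (merge t p q) x \<le> tdeg V t x"
proof -
  define W where "W = V - {p, q}"
  have W: "finite W" "p \<notin> W" "q \<notin> insert p W" "V = insert q (insert p W)" "V - {q} = insert p W"
    using fin pq by (auto simp: W_def)
  have "tdeg (V - {q}) (merge t p q) x = \<bar>t x p + t x q\<bar> + (\<Sum>y\<in>W. \<bar>t x y\<bar>)"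
    unfolding tdeg_def W(5) using W x by (auto simp: merge_def intro!: sum.cong)
  moreover have "tdeg V t x = \<bar>t x p\<bar> + \<bar>t x q\<bar> + (\<Sum>y\<in>W. \<bar>t x y\<bar>)"
    using W pq by (simp add: tdeg_def)
  ultimately show ?thesis by linarith
qed

lemma tdeg_remove:
  assumes "finite V" "a \<in> V"
  shows "tdeg (V - {a}) t v = tdeg V t v - \<bar>t v a\<bar>"
  using assms by (simp add: tdeg_def sum.remove)

lemma merge_overlap_remove:
  assumes "finite V" "a \<in> V"
  shows "merge_overlap (V - {a}) t p q = merge_overlap V t p q - overlap (t p a) (t q a)"
  using assms by (simp add: merge_overlap_def sum.remove)

lemma merge_overlap_support:
  assumes "finite V" "S \<subseteq> V" "\<And>x. x \<in> V \<Longrightarrow> x \<notin> S \<Longrightarrow> t q x = 0"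
  shows "merge_overlap V t p q = (\<Sum>x\<in>S. overlap (t p x) (t q x))"
  unfolding merge_overlap_def using assms by (intro sum.mono_neutral_right) auto

datatype 'a move = First (moved: 'a) | Last (moved: 'a)

text \<open>The list \<open>rs\<close> collects the vertices that have already been moved out of \<open>V\<close>.\<close>

fun moves_cost :: "'a set \<Rightarrow> ('a \<Rightarrow> 'a \<Rightarrow> int) \<Rightarrow> 'a list \<Rightarrow> 'a move list \<Rightarrow> int" where
  "moves_cost V t rs [] = 0"
| "moves_cost V t rs (First v # ms) =
     first_cost V t v - (\<Sum>u\<leftarrow>rs. penalty (t v u)) + moves_cost V t (v # rs) ms"
| "moves_cost V t rs (Last v # ms) =
     last_cost V t v - (\<Sum>u\<leftarrow>rs. penalty (t u v)) + moves_cost V t (v # rs) ms"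

lemma first_cost_Diff:
  assumes "finite V" "set rs \<subseteq> V" "distinct rs"
  shows "first_cost (V - set rs) t v = first_cost V t v - (\<Sum>u\<leftarrow>rs. penalty (t v u))"
  using assms by (simp add: first_cost_def sum_diff sum_list_distinct_conv_sum_set)

lemma last_cost_Diff:
  assumes "finite V" "set rs \<subseteq> V" "distinct rs"
  shows "last_cost (V - set rs) t v = last_cost V t v - (\<Sum>u\<leftarrow>rs. penalty (t u v))"
  using assms by (simp add: last_cost_def sum_diff sum_list_distinct_conv_sum_set)

text \<open>The statement is about \<open>V - set rs\<close> rather than \<open>V\<close>, so that
  the induction can proceed after a vertex has been moved out.\<close>

lemma orderable_moves:
  assumes fin: "finite V" and t0: "\<And>x. t x x = 0"
  shows "distinct (rs @ map moved ms) \<Longrightarrow> set (rs @ map moved ms) \<subseteq> V \<Longrightarrow>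
    orderable (V - set rs - moved ` set ms) t k \<Longrightarrow>
    orderable (V - set rs) t (k + moves_cost V t rs ms)"
proof (induction ms arbitrary: rs)
  case Nil
  then show ?case by simp
next
  case (Cons m ms)
  define v where "v = moved m"
  have eq: "V - set rs - moved ` set (m # ms) = V - set (v # rs) - moved ` set ms"
    "V - set (v # rs) = V - set rs - {v}"
    by (auto simp: v_def)
  have ord: "orderable (V - set rs - {v}) t (k + moves_cost V t (v # rs) ms)"
    using Cons.IH[of "v # rs"] Cons.prems eq by (simp add: v_def)
  have v: "v \<in> V - set rs" "finite (V - set rs)" "set rs \<subseteq> V" "distinct rs"
    using Cons.prems fin by (auto simp: v_def)
  show ?case
  proof (cases m)
    case (First u)
    then show ?thesis
      using orderable_place_first[OF v(2,1) t0 ord] first_cost_Diff[OF fin v(3,4), of t v]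
      by (simp add: v_def add.assoc add.commute)
  next
    case (Last u)
    then show ?thesis
      using orderable_place_last[OF v(2,1) t0 ord] last_cost_Diff[OF fin v(3,4), of t v]
      by (simp add: v_def add.assoc add.commute)
  qed
qed

lemma merge_overlap_commute: "merge_overlap V t p q = merge_overlap V t q p"
  by (simp add: merge_overlap_def overlap_def add.commute)

section \<open>Minimal counterexamples\<close>

text \<open>Smaller instances over the same vertex type suffice, since a merged vertex reuses the
  name \<open>p\<close>. Their weights are arbitrary because merging changes them.\<close>

locale minimal_counterexample =
  fixes V :: "'a set" and t :: "'a \<Rightarrow> 'a \<Rightarrow> int"
  assumes fin: "finite V"
    and antisym: "t x y = - t y x"
    and tdeg_le: "v \<in> V \<Longrightarrow> tdeg V t v \<le> 5"
    and not_orderable: "\<not> orderable V t 0"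
    and minimal: "\<And>(U :: 'a set) s. card U < card V \<Longrightarrow> finite U \<Longrightarrow> (\<And>x y. s x y = - s y x) \<Longrightarrow>
      (\<And>v. v \<in> U \<Longrightarrow> tdeg U s v \<le> 5) \<Longrightarrow> orderable U s 0"
begin

lemma t_self [simp]: "t x x = 0"
  using antisym[of x x] by linarith

lemma reverse_arc:
  "t u v = 1 \<Longrightarrow> t v u = - 1"
  "t u v = - 1 \<Longrightarrow> t v u = 1"
  "t u v = 0 \<Longrightarrow> t v u = 0"
  using antisym[of v u] by simp_all

abbreviation fc :: "'a \<Rightarrow> int" where "fc \<equiv> first_cost V t"
abbreviation lc :: "'a \<Rightarrow> int" where "lc \<equiv> last_cost V t"

lemma tdeg_eq: "tdeg V t v = fc v + lc v"
proof -
  have "\<bar>t v u\<bar> = penalty (t v u) + penalty (t u v)" for u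
    using antisym[of v u] by (simp add: penalty_def)
  then show ?thesis
    by (simp add: tdeg_def first_cost_def last_cost_def sum.distrib)
qed

text \<open>A vertex with \<open>o\<close> outgoing and \<open>i\<close> incoming arcs has costs \<open>2 i - o\<close> and \<open>2 o - i\<close>.\<close>

lemma out_sum: "3 * (\<Sum>u | u \<in> V \<and> t v u > 0. t v u) = fc v + 2 * lc v"
proof -
  have "3 * (\<Sum>u | u \<in> V \<and> t v u > 0. t v u) = (\<Sum>u\<in>V. if t v u > 0 then 3 * t v u else 0)"
    unfolding sum_distrib_left using fin by (rule sum.inter_filter)
  also have "\<dots> = (\<Sum>u\<in>V. penalty (t v u) + 2 * penalty (t u v))"
  proof (intro sum.cong refl)
    fix u show "(if t v u > 0 then 3 * t v u else 0) = penalty (t v u) + 2 * penalty (t u v)"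
      using antisym[of u v] by (simp add: penalty_def)
  qed
  finally show ?thesis
    by (simp add: first_cost_def last_cost_def sum.distrib sum_distrib_left)
qed

lemma in_sum: "3 * (\<Sum>u | u \<in> V \<and> t u v > 0. t u v) = 2 * fc v + lc v"
proof -
  have "3 * (\<Sum>u | u \<in> V \<and> t u v > 0. t u v) = (\<Sum>u\<in>V. if t u v > 0 then 3 * t u v else 0)"
    unfolding sum_distrib_left using fin by (rule sum.inter_filter)
  also have "\<dots> = (\<Sum>u\<in>V. 2 * penalty (t v u) + penalty (t u v))"
  proof (intro sum.cong refl)
    fix u show "(if t u v > 0 then 3 * t u v else 0) = 2 * penalty (t v u) + penalty (t u v)"
      using antisym[of u v] by (simp add: penalty_def)
  qed
  finally show ?thesis
    by (simp add: first_cost_def last_cost_def sum.distrib sum_distrib_left)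
qed

section \<open>What minimality says about the reductions\<close>

lemma orderable_sub:
  assumes "U \<subset> V"
  shows "orderable U t 0"
proof (rule minimal)
  show "card U < card V" "finite U"
    using assms fin by (auto intro: psubset_card_mono finite_subset)
  fix v assume "v \<in> U"
  have "tdeg U t v \<le> tdeg V t v"
    unfolding tdeg_def using assms fin by (intro sum_mono2) auto
  with tdeg_le[of v] \<open>v \<in> U\<close> assms show "tdeg U t v \<le> 5" by auto
qed (rule antisym)

text \<open>An ordering of the remaining vertices would extend to \<open>V\<close> at the total cost
  of the moves. Most exclusions below exhibit moves of cost at most 0. An arc from a moved vertex to
  \<open>v\<close> lowers the first cost of \<open>v\<close> by 2, one from \<open>v\<close> to a
  moved vertex raises it by 1; dually for last costs.\<close>

lemma moves:
  assumes "ms \<noteq> []" "distinct (map moved ms)" "moved ` set ms \<subseteq> V"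
  shows "moves_cost V t [] ms \<ge> 1"
proof (rule ccontr)
  assume *: "\<not> ?thesis"
  have "V - moved ` set ms \<subset> V"
    using assms by (cases ms) auto
  from orderable_sub[OF this] have "orderable V t (moves_cost V t [] ms)"
    using orderable_moves[of V t "[]" ms 0, OF fin t_self] assms by simp
  with * not_orderable show False
    using orderable_mono[of V t _ 0] by auto
qed

text \<open>The numerical hypothesis is the degree bound for the merged vertex; no other degree can
  grow.\<close>

lemma contract:
  assumes "p \<in> V" "q \<in> V" "p \<noteq> q"
    and "fc p + lc p + fc q + lc q - 2 * \<bar>t p q\<bar> - 2 * merge_overlap V t p q \<le> 5"
  shows "penalty (t p q) + merge_overlap V t p q \<ge> 1"
proof (rule ccontr)
  assume *: "\<not> ?thesis"
  have "orderable (V - {q}) (merge t p q) 0"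
  proof (rule minimal)
    show "card (V - {q}) < card V"
      using assms by (intro psubset_card_mono fin) auto
    show "finite (V - {q})"
      using fin by simp
    show "merge t p q x y = - merge t p q y x" for x y
      by (rule merge_antisym) (rule antisym)
    fix v assume v: "v \<in> V - {q}"
    show "tdeg (V - {q}) (merge t p q) v \<le> 5"
    proof (cases "v = p")
      case True
      with assms tdeg_merge[OF fin assms(1-3) antisym] show ?thesis
        by (simp add: tdeg_eq)
    next
      case False
      with v tdeg_le[of v] tdeg_merge_other[OF fin assms(1-3), of v t] show ?thesis by auto
    qed
  qed
  from orderable_merge[OF fin assms(1-3) antisym this] * show False
    using not_orderable orderable_mono[of V t _ 0] by auto
qed

lemma remove_contract:
  assumes "a \<in> V" "p \<in> V" "q \<in> V" "distinct [a, p, q]"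
    and deg: "fc p + lc p - \<bar>t p a\<bar> + fc q + lc q - \<bar>t q a\<bar> - 2 * \<bar>t p q\<bar>
      - 2 * merge_overlap (V - {a}) t p q \<le> 5"
  shows "fc a + penalty (t p q) + merge_overlap (V - {a}) t p q \<ge> 1"
proof (rule ccontr)
  assume *: "\<not> ?thesis"
  let ?U = "V - {a}"
  have U: "finite ?U" "p \<in> ?U" "q \<in> ?U" "p \<noteq> q"
    using assms fin by auto
  have "orderable (?U - {q}) (merge t p q) 0"
  proof (rule minimal)
    show "card (?U - {q}) < card V"
      using assms by (intro psubset_card_mono fin) auto
    show "finite (?U - {q})"
      using fin by simp
    show "merge t p q x y = - merge t p q y x" for x y
      by (rule merge_antisym) (rule antisym)
    fix v assume v: "v \<in> ?U - {q}"
    show "tdeg (?U - {q}) (merge t p q) v \<le> 5"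
    proof (cases "v = p")
      case True
      with assms deg fin tdeg_merge[OF U antisym] show ?thesis
        by (simp add: tdeg_remove tdeg_eq)
    next
      case False
      have "tdeg ?U t v \<le> 5"
        using tdeg_remove[OF fin assms(1), of t v] tdeg_le[of v] v by auto
      with False tdeg_merge_other[OF U, of v t] show ?thesis by linarith
    qed
  qed
  from orderable_place_first[OF fin assms(1) t_self orderable_merge[OF U antisym this]] * show False
    using not_orderable orderable_mono[of V t _ 0] by (auto simp: algebra_simps)
qed

text \<open>(out-degree, in-degree) is (2,2), (3,2) and (2,3), respectively.\<close>

definition balanced :: "'a \<Rightarrow> bool" where
  "balanced v \<longleftrightarrow> v \<in> V \<and> fc v = 2 \<and> lc v = 2"

definition out_heavy :: "'a \<Rightarrow> bool" where
  "out_heavy v \<longleftrightarrow> v \<in> V \<and> fc v = 1 \<and> lc v = 4"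

definition in_heavy :: "'a \<Rightarrow> bool" where
  "in_heavy v \<longleftrightarrow> v \<in> V \<and> fc v = 4 \<and> lc v = 1"

section \<open>Vertex types and neighbourhoods\<close>

text \<open>Such a vertex has one incoming and one outgoing arc. Merging it into its in-neighbour
  gains at least 1, and its other arc creates at most one overlap.\<close>

lemma costs_not_1_1:
  assumes "v \<in> V" shows "\<not> (fc v = 1 \<and> lc v = 1)"
proof
  assume *: "fc v = 1 \<and> lc v = 1"
  have "(\<Sum>u | u \<in> V \<and> t u v > 0. t u v) \<noteq> 0"
    using in_sum[of v] * by auto
  then obtain u where u: "u \<in> V" "t u v > 0"
    by (metis (mono_tags, lifting) mem_Collect_eq sum.neutral)
  have "u \<noteq> v" using u by auto
  have "merge_overlap V t u v = (\<Sum>x\<in>V - {u}. overlap (t u x) (t v x))"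
    using u fin by (simp add: merge_overlap_def sum.remove)
  also have "\<dots> \<le> (\<Sum>x\<in>V - {u}. \<bar>t v x\<bar>)"
    by (intro sum_mono overlap_le)
  also have "\<dots> = 2 - t u v"
    using tdeg_eq[of v] * u fin antisym[of v u] by (simp add: tdeg_def sum.remove)
  finally have "merge_overlap V t u v \<le> 2 - t u v" .
  moreover have "penalty (t u v) + merge_overlap V t u v \<ge> 1"
    using u assms \<open>u \<noteq> v\<close> * tdeg_le[of u] merge_overlap_nonneg[of V t u v]
    by (intro contract) (auto simp: tdeg_eq)
  ultimately show False
    using u by (simp add: penalty_def)
qed

text \<open>Both costs are positive, have sum at most 5 and, by \<open>out_sum\<close>, are
  congruent modulo 3. This leaves only the pairs (1,1), (2,2), (1,4) and (4,1).\<close>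

lemma vertex_types: "v \<in> V \<Longrightarrow> balanced v \<or> out_heavy v \<or> in_heavy v"
proof -
  assume v: "v \<in> V"
  have "fc v \<ge> 1" "lc v \<ge> 1"
    using moves[of "[First v]"] moves[of "[Last v]"] v by auto
  then show ?thesis
    using out_sum[of v] tdeg_le[OF v] costs_not_1_1[OF v] v
    unfolding tdeg_eq balanced_def out_heavy_def in_heavy_def by smt
qed

text \<open>Every vertex can be moved to some end at cost at most 2. Moving \<open>u\<close> lowers
  the first cost of \<open>v\<close> by at least 4, and moving \<open>v\<close> lowers the last cost
  of \<open>u\<close> by as much, so both of these costs must be 4.\<close>

lemma multiple_arc:
  assumes "u \<in> V" "v \<in> V" "t u v \<ge> 2"
  shows "out_heavy u \<and> in_heavy v \<and> t u v = 2"
proof -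
  have ne: "u \<noteq> v" using assms by auto
  have vu: "t v u = - t u v" by (rule antisym)
  show ?thesis
    using vertex_types[OF assms(1)] vertex_types[OF assms(2)] assms vu ne
      moves[of "[First u, First v]"] moves[of "[Last u, First v]"] moves[of "[Last v, Last u]"]
      moves[of "[First v, Last u]"]
    by (auto simp: balanced_def out_heavy_def in_heavy_def penalty_def)
qed

lemma balanced_arc:
  assumes "balanced v" "u \<in> V"
  shows "t v u = - 1 \<or> t v u = 0 \<or> t v u = 1"
proof -
  have "\<not> t v u \<ge> 2" "\<not> t u v \<ge> 2"
    using multiple_arc[of v u] multiple_arc[of u v] assms
    by (auto simp: balanced_def out_heavy_def in_heavy_def)
  then show ?thesis using antisym[of u v] by linarith
qed

text \<open>All weights at \<open>v\<close> are at most 1 in absolute value, so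
  \<open>out_sum\<close> and \<open>in_sum\<close> count neighbours: \<open>a\<close>,
  \<open>b\<close> are the in-neighbours and \<open>c\<close>, \<open>d\<close> the
  out-neighbours.\<close>

lemma balanced_neighbours:
  assumes "balanced v"
  obtains a b c d where "{a, b, c, d} \<subseteq> V" "distinct [a, b, c, d]"
    "t v a = - 1" "t v b = - 1" "t v c = 1" "t v d = 1"
    "\<And>x. x \<in> V \<Longrightarrow> x \<notin> {a, b, c, d} \<Longrightarrow> t v x = 0"
proof -
  have v: "v \<in> V" "fc v = 2" "lc v = 2" using assms by (auto simp: balanced_def)
  have "(\<Sum>u | u \<in> V \<and> t v u > 0. t v u) = (\<Sum>u | u \<in> V \<and> t v u > 0. 1)"
    using balanced_arc[OF assms] by (intro sum.cong) force+
  with out_sum[of v] v have "card {u\<in>V. t v u > 0} = 2" by simp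
  then obtain c d where cd: "{u\<in>V. t v u > 0} = {c, d}" "c \<noteq> d"
    by (auto simp: card_2_iff)
  have "(\<Sum>u | u \<in> V \<and> t u v > 0. t u v) = (\<Sum>u | u \<in> V \<and> t u v > 0. 1)"
  proof (intro sum.cong refl)
    fix u assume "u \<in> {u\<in>V. t u v > 0}"
    then show "t u v = 1" using balanced_arc[OF assms, of u] antisym[of u v] by auto
  qed
  with in_sum[of v] v have "card {u\<in>V. t u v > 0} = 2" by simp
  then obtain a b where ab: "{u\<in>V. t u v > 0} = {a, b}" "a \<noteq> b"
    by (auto simp: card_2_iff)
  have out: "u \<in> V \<and> t v u > 0 \<longleftrightarrow> u = c \<or> u = d" for u
    using cd(1) by blast
  have "u \<in> V \<and> t u v > 0 \<longleftrightarrow> u = a \<or> u = b" for u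
    using ab(1) by blast
  then have inn: "u \<in> V \<and> t v u < 0 \<longleftrightarrow> u = a \<or> u = b" for u
    using antisym[of u v] by (metis neg_0_less_iff_less)
  show thesis
  proof (rule that[of a b c d])
    show "{a, b, c, d} \<subseteq> V" "distinct [a, b, c, d]"
      using out[of c] out[of d] inn[of a] inn[of b] ab(2) cd(2) by auto
    show "t v a = - 1" "t v b = - 1" "t v c = 1" "t v d = 1"
      using out[of c] out[of d] inn[of a] inn[of b] balanced_arc[OF assms, of a]
        balanced_arc[OF assms, of b] balanced_arc[OF assms, of c] balanced_arc[OF assms, of d]
      by auto
    show "t v x = 0" if "x \<in> V" "x \<notin> {a, b, c, d}" for x
      using that out[of x] inn[of x] by auto
  qed
qed

lemma balanced_neighbours_out:
  assumes "balanced v" "c \<in> V" "t v c = 1"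
  obtains a b d where "{a, b, d} \<subseteq> V" "distinct [a, b, c, d]"
    "t v a = - 1" "t v b = - 1" "t v d = 1"
    "\<And>x. x \<in> V \<Longrightarrow> x \<notin> {a, b, c, d} \<Longrightarrow> t v x = 0"
proof -
  obtain a b c' d' where *: "{a, b, c', d'} \<subseteq> V" "distinct [a, b, c', d']"
    "t v a = - 1" "t v b = - 1" "t v c' = 1" "t v d' = 1"
    "\<And>x. x \<in> V \<Longrightarrow> x \<notin> {a, b, c', d'} \<Longrightarrow> t v x = 0"
    using balanced_neighbours[OF assms(1)] by metis
  then have "c = c' \<or> c = d'" using assms by force
  then show thesis
    using that[of a b d'] that[of a b c'] * by (auto simp: insert_commute)
qed

lemma balanced_neighbours_in:
  assumes "balanced v" "a \<in> V" "t v a = - 1"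
  obtains b c d where "{b, c, d} \<subseteq> V" "distinct [a, b, c, d]"
    "t v b = - 1" "t v c = 1" "t v d = 1"
    "\<And>x. x \<in> V \<Longrightarrow> x \<notin> {a, b, c, d} \<Longrightarrow> t v x = 0"
proof -
  obtain a' b' c d where *: "{a', b', c, d} \<subseteq> V" "distinct [a', b', c, d]"
    "t v a' = - 1" "t v b' = - 1" "t v c = 1" "t v d = 1"
    "\<And>x. x \<in> V \<Longrightarrow> x \<notin> {a', b', c, d} \<Longrightarrow> t v x = 0"
    using balanced_neighbours[OF assms(1)] by metis
  then have "a = a' \<or> a = b'" using assms by force
  then show thesis
    using that[of b' c d] that[of a' c d] * by (auto simp: insert_commute)
qed

text \<open>Overlaps are paths of length two, from \<open>p\<close> to \<open>v\<close> through an
  in-neighbour of \<open>v\<close> or from \<open>v\<close> to \<open>p\<close> through an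
  out-neighbour. If there is an arc from \<open>p\<close> to \<open>v\<close>, the former give
  transitive triangles and the latter directed ones.\<close>

lemma merge_overlap_balanced:
  assumes "{a, b, c, d} \<subseteq> V" "distinct [a, b, c, d]"
    "t v a = - 1" "t v b = - 1" "t v c = 1" "t v d = 1"
    "\<And>x. x \<in> V \<Longrightarrow> x \<notin> {a, b, c, d} \<Longrightarrow> t v x = 0"
  shows "merge_overlap V t p v = of_bool (t p a > 0) + of_bool (t p b > 0)
    + of_bool (t p c < 0) + of_bool (t p d < 0)"
  using assms by (subst merge_overlap_support[OF fin assms(1)])
    (auto simp: overlap_right_1 overlap_right_m1)

section \<open>Excluding heavy vertices\<close>

text \<open>A heavy \<open>v\<close> could be moved to one of the ends at cost 1, after which
  placing \<open>a\<close> first costs at most -1.\<close>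

lemma in_neighbour_out_heavy:
  assumes "out_heavy a" "v \<in> V" "t v a > 0"
  shows "balanced v"
proof -
  have ne: "v \<noteq> a" using assms by auto
  have "t a v = - t v a" by (rule antisym)
  then show ?thesis
    using vertex_types[OF assms(2)] assms ne
      moves[of "[First v, First a]"] moves[of "[Last v, First a]"]
    by (auto simp: out_heavy_def in_heavy_def penalty_def)
qed

lemma out_neighbour_in_heavy:
  assumes "in_heavy b" "v \<in> V" "t b v > 0"
  shows "balanced v"
proof -
  have ne: "v \<noteq> b" using assms by auto
  have "t v b = - t b v" by (rule antisym)
  then show ?thesis
    using vertex_types[OF assms(2)] assms ne
      moves[of "[First v, Last b]"] moves[of "[Last v, Last b]"]
    by (auto simp: out_heavy_def in_heavy_def penalty_def)
qed

text \<open>The arcs at \<open>w\<close> come from \<open>x\<close>, \<open>y\<close> and go to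
  \<open>a\<close>, \<open>z\<close>. Merging \<open>w\<close> with \<open>a\<close> shows that
  \<open>a\<close> has arcs to both of \<open>x\<close>, \<open>y\<close> or to neither, and the two
  cases are refuted separately.\<close>

lemma no_out_heavy_aux:
  assumes A: "out_heavy a" and w: "balanced w" and x: "balanced x"
    and y: "balanced y \<or> in_heavy y"
    and V: "{x, y, a, z} \<subseteq> V" and dist: "distinct [x, y, a, z]"
    and wt: "t w x = - 1" "t w y = - 1" "t w a = 1" "t w z = 1"
      "\<And>u. u \<in> V \<Longrightarrow> u \<notin> {x, y, a, z} \<Longrightarrow> t w u = 0"
    and z: "balanced z \<or> in_heavy z"
    and ya: "in_heavy y \<Longrightarrow> t a y > 0"
  shows False
proof -
  note heavy = balanced_def out_heavy_def in_heavy_def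
  have inV: "a \<in> V" "w \<in> V" "x \<in> V" "y \<in> V" "z \<in> V"
    using V w by (auto simp: balanced_def)
  have ne: "w \<noteq> x" "w \<noteq> y" "w \<noteq> a" "w \<noteq> z"
    "x \<noteq> y" "x \<noteq> a" "x \<noteq> z" "y \<noteq> a" "y \<noteq> z" "a \<noteq> z"
    using wt dist by auto
  note ne = ne ne[symmetric]
  have tw: "t x w = 1" "t y w = 1" "t a w = - 1" "t z w = - 1"
    using wt by (blast intro: reverse_arc)+
  have K: "merge_overlap V t p w = of_bool (t p x > 0) + of_bool (t p y > 0)
      + of_bool (t p a < 0) + of_bool (t p z < 0)" for p
    using merge_overlap_balanced[OF V dist wt] .
  txt \<open>Merging along a unit arc loses nothing if it creates exactly one pair of opposite arcs, so the
    overlaps at \<open>w\<close> computed below differ from 1.\<close>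
  have za: "\<not> t z a > 0"
  proof
    assume "t z a > 0"
    moreover from this have "balanced z"
      using in_neighbour_out_heavy[OF A inV(5)] by simp
    ultimately show False
      using moves[of "[First w, First z, First a]"] A w inV ne tw wt(1-4) antisym[of a z]
      by (simp add: heavy penalty_def)
  qed
  have xa: "\<not> t a x > 0 \<longleftrightarrow> \<not> t a y > 0"
  proof (rule ccontr)
    assume *: "\<not> ?thesis"
    have "merge_overlap V t w a = 1"
      using * K[of a] za antisym[of a z] by (subst merge_overlap_commute) auto
    then show False
      using contract[of w a] A w inV ne wt(1-4) by (simp add: heavy)
  qed
  have xy: "t x y = 0" if "balanced y"
  proof -
    have "t y x = - t x y" by (rule antisym)
    then show ?thesis
      using that moves[of "[First x, First y, First w]"] moves[of "[First y, First x, First w]"]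
        w x inV ne tw wt(1-4) balanced_arc[OF x, of y]
      by (auto simp: heavy penalty_def)
  qed
  show False
  proof (cases "t a x > 0")
    case True
    then have ax: "t a x = 1" "t x a = - 1"
      using balanced_arc[OF x inV(1)] antisym[of a x] by auto
    have ay: "t a y > 0" "t y a < 0"
      using True xa antisym[of a y] by auto
    have xy': "\<not> t x y > 0"
    proof
      assume "t x y > 0"
      with xy y balanced_arc[OF x inV(4)] have "in_heavy y" "t x y = 1" "t y x = - 1"
        using antisym[of y x] by auto
      then show False
        using moves[of "[First a, First x, First y, First w]"] A w x inV ne tw wt(1-4) ax ay
        by (simp add: heavy penalty_def)
    qed
    have "merge_overlap V t x w \<noteq> 1"
      using contract[of x w] w x inV ne tw by (auto simp: heavy)
    then have zx: "t x z < 0"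
      using K[of x] ax xy' by (auto split: if_splits)
    then have zx: "t x z = - 1" "t z x = 1"
      using balanced_arc[OF x inV(5)] antisym[of z x] by auto
    \<comment> \<open>The two in-neighbours of \<open>x\<close> are already known to be
      \<open>a\<close> and \<open>z\<close>.\<close>
    have yx: "t x y = 0"
    proof -
      obtain b c d where b: "{b, c, d} \<subseteq> V" "distinct [a, b, c, d]"
        "t x b = - 1" "t x c = 1" "t x d = 1"
        "\<And>u. u \<in> V \<Longrightarrow> u \<notin> {a, b, c, d} \<Longrightarrow> t x u = 0"
        using balanced_neighbours_in[OF x inV(1) ax(2)] by blast
      have "z = b"
        using b(4-5) b(6)[OF inV(5)] zx ne by force
      then have "t x y \<noteq> - 1"
        using b(4-5) b(6)[OF inV(4)] ne by force
      then show ?thesis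
        using balanced_arc[OF x inV(4)] xy' by auto
    qed
    then have yx: "t x y = 0" "t y x = 0"
      using antisym[of y x] by auto
    have "merge_overlap V t y w \<noteq> 1"
      using contract[of y w] y w inV ne tw by (auto simp: heavy)
    then have zy: "t y z < 0"
      using K[of y] ay yx by (auto split: if_splits)
    then have zy': "t z y > 0" using antisym[of z y] by auto
    show False
    proof (cases "balanced y")
      case True
      have zy'': "t y z = - 1" "t y a = - 1"
        using balanced_arc[OF True] inV zy ay by fastforce+
      have "t a z \<le> 2"
        using moves[of "[First a, First z]"] A z inV ne antisym[of z a]
        by (auto simp: heavy penalty_def split: if_splits)
      \<comment> \<open>With \<open>a\<close> and \<open>z\<close> gone, \<open>x\<close> and
        \<open>y\<close> have no incoming arcs left and cost -2 each. This pays for \<open>a\<close>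
        and for moving \<open>z\<close> to its cheaper end.\<close>
      then show False
        using z moves[of "[First a, First z, First x, First y]"]
          moves[of "[First a, Last z, First x, First y]"] A x True inV ne ax ay yx zx zy'' za
          antisym[of a z]
        by (auto simp: heavy penalty_def split: if_splits)
    next
      case False
      with y have "in_heavy y" by simp
      have "balanced z"
        using z out_neighbour_in_heavy[of z y] zy' False inV by auto
      then show False
        using moves[of "[First a, Last w, First z, First x]"] A w x inV ne tw wt(1-4) ax zx za
        by (simp add: heavy penalty_def split: if_splits)
    qed
  next
    case False
    have y: "balanced y"
      using False xa y ya by auto
    have xa': "t x a \<ge> 0"
      using False antisym[of a x] by simp
    have "merge_overlap V t x w \<noteq> 1"
      using contract[of x w] w x inV ne tw by (auto simp: heavy)
    then have K0: "merge_overlap V t x w = 0"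
      using K[of x] xa' xy[OF y] by (auto split: if_splits)
    have "merge_overlap (V - {a}) t x w = 0"
      using merge_overlap_remove[OF fin inV(1), of t x w] K0 overlap_nonneg[of "t x a" "t w a"]
        merge_overlap_nonneg[of "V - {a}" t x w] by linarith
    \<comment> \<open>Placing \<open>a\<close> first costs 1 and lowers the degree of
      \<open>w\<close> to 3. The merger of \<open>x\<close> and \<open>w\<close> then respects the
      degree bound and gains 1.\<close>
    then show False
      using remove_contract[of a x w] A w x inV ne tw wt(1-4) by (simp add: heavy)
  qed
qed

lemma no_out_heavy: "\<not> out_heavy a"
proof
  assume A: "out_heavy a"
  note heavy = balanced_def out_heavy_def in_heavy_def
  have aV: "a \<in> V" using A by (simp add: out_heavy_def)
  have "(\<Sum>u | u \<in> V \<and> t u a > 0. t u a) \<noteq> 0"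
    using in_sum[of a] A by (auto simp: out_heavy_def)
  then obtain w where w: "w \<in> V" "t w a > 0"
    by (metis (mono_tags, lifting) mem_Collect_eq sum.neutral)
  have bw: "balanced w"
    using in_neighbour_out_heavy[OF A w] .
  have wa: "t w a = 1" "t a w = - 1"
    using balanced_arc[OF bw aV] w antisym[of a w] by auto
  obtain x y z where V: "{x, y, z} \<subseteq> V" and dist: "distinct [x, y, a, z]"
    and wt: "t w x = - 1" "t w y = - 1" "t w z = 1"
      "\<And>u. u \<in> V \<Longrightarrow> u \<notin> {x, y, a, z} \<Longrightarrow> t w u = 0"
    using balanced_neighbours_out[OF bw aV wa(1)] by metis
  have inV: "x \<in> V" "y \<in> V" "z \<in> V" using V by auto
  have ne: "w \<noteq> x" "w \<noteq> y" "w \<noteq> a" "w \<noteq> z"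
    "x \<noteq> y" "x \<noteq> a" "x \<noteq> z" "y \<noteq> a" "y \<noteq> z" "a \<noteq> z"
    using wt wa dist by auto
  note ne = ne ne[symmetric]
  have tw: "t x w = 1" "t y w = 1" "t z w = - 1"
    using wt by (blast intro: reverse_arc)+
  have heavy_pair: "t a u = 0" "t u a = 0" if "out_heavy u" "u \<in> V" for u
  proof -
    have "\<not> t a u > 0" "\<not> t u a > 0"
      using in_neighbour_out_heavy[OF that(1) aV] in_neighbour_out_heavy[OF A that(2)] A that
      by (auto simp: heavy)
    then show "t a u = 0" "t u a = 0" using antisym[of a u] by auto
  qed
  have wc: "fc w = 2" "lc w = 2" and ac: "fc a = 1" "lc a = 4"
    using bw A by (simp_all add: heavy)
  have "\<not> out_heavy z"
  proof
    assume z: "out_heavy z"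
    from this inV(3) have "t a z = 0" "t z a = 0" by (rule heavy_pair)+
    with z show False
      using moves[of "[First w, First a, First z]"] aV inV(3) w(1) ne wa tw(3) wc ac
      by (simp add: out_heavy_def)
  qed
  then have z: "balanced z \<or> in_heavy z"
    using vertex_types[OF inV(3)] by blast
  have xy: "balanced u \<or> in_heavy u" and ya: "in_heavy u \<Longrightarrow> t a u > 0"
    if u: "u \<in> V" "t w u = - 1" "t u w = 1" for u
  proof -
    have ne: "u \<noteq> w" "w \<noteq> u" "u \<noteq> a" "a \<noteq> u" "w \<noteq> a" "a \<noteq> w" using u wa by auto
    have "\<not> out_heavy u"
    proof
      assume h: "out_heavy u"
      from this u(1) have "t a u = 0" "t u a = 0" by (rule heavy_pair)+
      with h show False
        using moves[of "[First u, First w, First a]"] aV w(1) u ne wa wc ac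
        by (simp add: out_heavy_def)
    qed
    then show "balanced u \<or> in_heavy u"
      using vertex_types[OF u(1)] by blast
    assume "in_heavy u"
    then show "t a u > 0"
      using moves[of "[First w, First a, Last u]"] aV w(1) u ne wa wc ac
      by (simp add: in_heavy_def penalty_def split: if_splits)
  qed
  \<comment> \<open>This makes one of them fit the role of \<open>x\<close> in
    \<open>no_out_heavy_aux\<close>, which is not symmetric in \<open>x\<close> and
    \<open>y\<close>.\<close>
  have "balanced x \<or> balanced y"
  proof (rule ccontr)
    assume "\<not> ?thesis"
    with xy[OF inV(1) wt(1) tw(1)] xy[OF inV(2) wt(2) tw(2)] have h: "in_heavy x" "in_heavy y"
      by auto
    have "\<not> t x y > 0" "\<not> t y x > 0"
      using out_neighbour_in_heavy[OF h(1) inV(2)] out_neighbour_in_heavy[OF h(2) inV(1)] h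
      by (auto simp: heavy)
    then have "t x y = 0" using antisym[of x y] by linarith
    with h show False
      using moves[of "[First w, Last x, Last y]"] w(1) inV ne wt(1,2) wc
      by (simp add: in_heavy_def)
  qed
  then show False
  proof
    assume "balanced x"
    show False
      by (rule no_out_heavy_aux[of a w x y z]) (use A bw \<open>balanced x\<close> xy[OF inV(1) wt(1) tw(1)] xy[OF inV(2) wt(2) tw(2)]
        ya[OF inV(1) wt(1) tw(1)] ya[OF inV(2) wt(2) tw(2)] z V aV dist wt wa in auto)
  next
    assume "balanced y"
    show False
      by (rule no_out_heavy_aux[of a w y x z]) (use A bw \<open>balanced y\<close> xy[OF inV(1) wt(1) tw(1)] xy[OF inV(2) wt(2) tw(2)]
        ya[OF inV(1) wt(1) tw(1)] ya[OF inV(2) wt(2) tw(2)] z V aV dist wt wa in auto)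
  qed
qed

lemma minimal_counterexample_transpose: "minimal_counterexample V (\<lambda>x y. t y x)"
proof
  show "finite V" by (rule fin)
  show "t y x = - t x y" for x y by (rule antisym)
  show "tdeg V (\<lambda>x y. t y x) v \<le> 5" if "v \<in> V" for v
  proof -
    have "\<bar>t u v\<bar> = \<bar>t v u\<bar>" for u using antisym[of u v] by simp
    with tdeg_le[OF that] show ?thesis by (simp add: tdeg_def)
  qed
  show "\<not> orderable V (\<lambda>x y. t y x) 0"
    using orderable_transpose[of V "\<lambda>x y. t y x" 0] not_orderable by auto
qed (rule minimal)

lemma all_balanced: "v \<in> V \<Longrightarrow> balanced v"
proof -
  assume v: "v \<in> V"
  interpret tr: minimal_counterexample V "\<lambda>x y. t y x" by (rule minimal_counterexample_transpose)
  have "\<not> in_heavy v"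
    using tr.no_out_heavy[of v]
    by (auto simp: in_heavy_def tr.out_heavy_def first_cost_def last_cost_def)
  with vertex_types[OF v] no_out_heavy show ?thesis by blast
qed

section \<open>The case in which all vertices are balanced\<close>

lemma arc_values: "u \<in> V \<Longrightarrow> v \<in> V \<Longrightarrow> t u v = - 1 \<or> t u v = 0 \<or> t u v = 1"
  using balanced_arc all_balanced by blast

lemma costs: "v \<in> V \<Longrightarrow> fc v = 2 \<and> lc v = 2"
  using all_balanced by (auto simp: balanced_def)

text \<open>Placing the vertices of a transitive triangle first, in their order, costs 2 + 0 -
  2.\<close>

lemma no_transitive_triangle:
  assumes "u \<in> V" "v \<in> V" "w \<in> V" "t u v = 1" "t u w = 1"
  shows "t v w = 0"
proof -
  have "t v u = - 1" "t w u = - 1" "t w v = - t v w"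
    using assms by (blast intro: reverse_arc antisym)+
  moreover have "u \<noteq> v" "u \<noteq> w" using assms by auto
  ultimately show ?thesis
    using moves[of "[First u, First v, First w]"] moves[of "[First u, First w, First v]"]
      assms costs arc_values[of v w]
    by (cases "v = w") (auto simp: penalty_def)
qed

lemma no_transitive_triangle':
  assumes "u \<in> V" "v \<in> V" "w \<in> V" "t v u = 1" "t w u = 1"
  shows "t v w = 0"
proof -
  have "t v w \<noteq> 1" "t w v \<noteq> 1"
    using no_transitive_triangle[of v u w] no_transitive_triangle[of w u v] assms antisym[of u w]
      antisym[of u v] by auto
  then show ?thesis using arc_values[of v w] assms antisym[of v w] by auto
qed

text \<open>Otherwise \<open>x y\<close> lies in just one directed triangle, so that merging \<open>x\<close> and \<open>y\<close> is free.\<close>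

lemma directed_triangle_out:
  assumes "x \<in> V" "y \<in> V" "z \<in> V" "t x y = 1" "t y z = 1" "t z x = 1"
    and "u \<in> V" "t y u = 1"
  shows "t u x = 1"
proof -
  have yx: "t y x = - 1" "t x z = - 1" using assms by (blast intro: reverse_arc)+
  have xy: "x \<noteq> y" using assms by auto
  obtain b c d where b: "{b, c, d} \<subseteq> V" "distinct [x, b, c, d]"
    "t y b = - 1" "t y c = 1" "t y d = 1"
    "\<And>v. v \<in> V \<Longrightarrow> v \<notin> {x, b, c, d} \<Longrightarrow> t y v = 0"
    using balanced_neighbours_in[OF all_balanced[OF assms(2)] assms(1) yx(1)] by metis
  have "t x b = 0"
    using no_transitive_triangle'[of y x b] assms b antisym[of b y] by auto
  then have K: "merge_overlap V t x y = of_bool (t x c < 0) + of_bool (t x d < 0)"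
    using merge_overlap_balanced[of x b c d y x] b assms yx by simp
  have "merge_overlap V t x y \<noteq> 1"
    using contract[of x y] assms costs xy by auto
  moreover have "z = c \<or> z = d" "u = c \<or> u = d"
    using b(3-5) b(6)[of z] b(6)[of u] assms yx by force+
  ultimately have "t x u < 0"
    using K yx by (auto split: if_splits)
  then show ?thesis
    using arc_values[of u x] assms antisym[of u x] by auto
qed

text \<open>By \<open>directed_triangle_out\<close>, both out-neighbours \<open>z\<close>,
  \<open>z'\<close> of \<open>y\<close> send their arcs to the same two vertices \<open>x\<close>
  and \<open>q\<close>. Placing \<open>z\<close>, \<open>z'\<close>, \<open>x\<close>,
  \<open>q\<close> first costs 2 + 2 - 2 - 2.\<close>

lemma no_directed_triangle:
  assumes xyz: "x \<in> V" "y \<in> V" "z \<in> V" "t x y = 1" "t y z = 1" "t z x = 1"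
  shows False
proof -
  obtain a b z' where z': "{a, b, z'} \<subseteq> V" "distinct [a, b, z, z']" "t y z' = 1"
    using balanced_neighbours_out[OF all_balanced[OF xyz(2)] xyz(3,5)] by metis
  then have z'x: "t z' x = 1"
    using directed_triangle_out[OF xyz] by auto
  obtain a b q where q: "{a, b, q} \<subseteq> V" "distinct [a, b, x, q]" "t z q = 1"
    using balanced_neighbours_out[OF all_balanced[OF xyz(3)] xyz(1,6)] by metis
  obtain a b q' where q': "{a, b, q'} \<subseteq> V" "distinct [a, b, x, q']" "t z' q' = 1"
    using balanced_neighbours_out[OF all_balanced[of z'] xyz(1) z'x] z'(1) by (metis insert_subset)
  have "t q y = 1" "t q' y = 1"
    using directed_triangle_out[of y z x q] directed_triangle_out[of y z' x q'] xyz z' z'x q q' by auto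
  obtain e c d where e: "{e, c, d} \<subseteq> V" "distinct [x, e, c, d]"
    "t y e = - 1" "t y c = 1" "t y d = 1"
    "\<And>v. v \<in> V \<Longrightarrow> v \<notin> {x, e, c, d} \<Longrightarrow> t y v = 0"
    using balanced_neighbours_in[OF all_balanced[OF xyz(2)] xyz(1)] xyz antisym[of y x] by metis
  have "q = e" "q' = e"
    using e q q' \<open>t q y = 1\<close> \<open>t q' y = 1\<close> antisym[of y q] antisym[of y q'] by force+
  then have q'': "t z' q = 1" using q' by simp
  have "t z z' = 0" "t x q = 0"
    using no_transitive_triangle[of y z z'] no_transitive_triangle[of z x q] xyz z' q by auto
  moreover have "t z' z = 0" "t q x = 0" "t x z = - 1" "t x z' = - 1" "t q z = - 1" "t q z' = - 1"
    using xyz z' z'x q q'' calculation by (blast intro: reverse_arc)+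
  moreover have "distinct [z, z', x, q]"
    using xyz z' z'x q q'' calculation by auto
  ultimately show False
    using moves[of "[First z, First z', First x, First q]"] costs xyz z' q
    by (simp add: penalty_def)
qed

text \<open>An overlap would complete a triangle on the arc from \<open>p\<close> to
  \<open>q\<close>. Merging along an arc therefore always gains 1, and only the degree bound can
  forbid it.\<close>

lemma arc_overlap:
  assumes "p \<in> V" "q \<in> V" "t p q = 1"
  shows "merge_overlap V t p q = 0"
proof -
  have "t q p = - 1" using assms antisym[of q p] by simp
  then obtain b c d where b: "{b, c, d} \<subseteq> V" "distinct [p, b, c, d]"
    "t q b = - 1" "t q c = 1" "t q d = 1"
    "\<And>v. v \<in> V \<Longrightarrow> v \<notin> {p, b, c, d} \<Longrightarrow> t q v = 0"
    using balanced_neighbours_in[OF all_balanced[OF assms(2)] assms(1)] by metis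
  have "t p b = 0"
    using no_transitive_triangle'[of q p b] assms b antisym[of b q] by auto
  moreover have "\<not> t p u < 0" if "u \<in> V" "t q u = 1" for u
    using no_directed_triangle[of p q u] arc_values[of u p] assms that antisym[of p u] by auto
  ultimately show ?thesis
    using merge_overlap_balanced[of p b c d q p] b assms \<open>t q p = - 1\<close> by simp
qed

lemma no_square:
  assumes "v \<in> V" "c \<in> V" "d \<in> V" "f \<in> V" "c \<noteq> d"
    and "t v c = 1" "t v d = 1" "t c f = 1" "t d f = 1"
  shows False
proof -
  have "t c d = 0" "t d c = 0"
    using no_transitive_triangle[of v] assms by auto
  moreover have "t c v = - 1" "t d v = - 1" "t f c = - 1" "t f d = - 1"
    using assms by (blast intro: reverse_arc)+
  moreover have "t f v \<noteq> 1"
    using no_directed_triangle[of v c f] assms by auto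
  moreover have "distinct [v, c, d, f]"
    using assms calculation by auto
  ultimately show False
    using moves[of "[First v, First c, First d, First f]"] costs assms arc_values[of f v]
    by (auto simp: penalty_def)
qed

text \<open>Placing \<open>v\<close> first costs 2 and leaves its out-neighbours \<open>c\<close>,
  \<open>d\<close> with degree 3. Each can then be merged with a neighbour of degree at most 4,
  giving degree at most 3 + 4 - 2 = 5 and gaining 1.\<close>

lemma inconsistent: False
proof -
  have "V \<noteq> {}"
    using not_orderable by (auto simp: orderable_def excess_def)
  then obtain v where v: "v \<in> V" by blast
  obtain c d where c: "c \<in> V" "t v c = 1" and d: "d \<in> V" "t v d = 1" and cd: "c \<noteq> d"
    using balanced_neighbours[OF all_balanced[OF v]]
    by (metis distinct_length_2_or_more insert_subset)
  have inv: "t c v = - 1" "t d v = - 1" using c d by (blast intro: reverse_arc)+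
  obtain e where e: "e \<in> V" "t d e = - 1" "e \<noteq> v"
    using balanced_neighbours_in[OF all_balanced[OF d(1)] v inv(2)]
    by (metis distinct_length_2_or_more insert_subset)
  then have ed: "t e d = 1" using antisym[of e d] by simp
  \<comment> \<open>Avoiding \<open>e\<close> keeps the two arcs to be merged, from \<open>c\<close>
    to \<open>f\<close> and from \<open>e\<close> to \<open>d\<close>, disjoint.\<close>
  obtain f where f: "f \<in> V" "t c f = 1" "f \<noteq> e"
    using balanced_neighbours[OF all_balanced[OF c(1)]]
    by (metis distinct_length_2_or_more insert_subset)
  have cd0: "t c d = 0" "t d c = 0"
    using no_transitive_triangle[of v] v c d by auto
  have ne: "v \<noteq> c" "v \<noteq> d" "v \<noteq> f" "c \<noteq> f" "f \<noteq> d" "d \<noteq> e" "e \<noteq> c"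
    using c d inv f e ed cd0 by auto
  have "t d f \<noteq> 1"
    using no_square[of v c d f] v c d f cd by auto
  moreover have "t d f \<noteq> - 1"
  proof
    assume "t d f = - 1"
    obtain b g h where "distinct [v, b, g, h]" "t d g = 1" "t d h = 1"
      "\<And>u. u \<in> V \<Longrightarrow> u \<notin> {v, b, g, h} \<Longrightarrow> t d u = 0"
      using balanced_neighbours_in[OF all_balanced[OF d(1)] v inv(2)] by metis
    then have "f = b" "e = b"
      using \<open>t d f = - 1\<close> e f(1) ne by force+
    with f show False by simp
  qed
  ultimately have df: "t d f = 0"
    using arc_values[of d f] d f by auto
  txt \<open>Since \<open>f\<close> and \<open>d\<close> are not adjacent, merging \<open>c\<close> with \<open>f\<close> does not affect the merger of \<open>e\<close> and \<open>d\<close>.\<close>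
  let ?U = "V - {v}"
  let ?s = "merge t c f"
  let ?W = "?U - {f}"
  let ?s' = "merge ?s e d"
  have anti: "?s x y = - ?s y x" for x y
    by (rule merge_antisym) (rule antisym)
  have anti': "?s' x y = - ?s' y x" for x y
    by (rule merge_antisym) (rule anti)
  have U: "finite ?U" "c \<in> ?U" "f \<in> ?U" "c \<noteq> f"
    using fin c f ne by auto
  have W: "finite ?W" "e \<in> ?W" "d \<in> ?W" "e \<noteq> d"
    using fin e d f ne by auto
  have K1: "merge_overlap ?U t c f = 0"
    using arc_overlap[OF c(1) f(1,2)] merge_overlap_nonneg[of ?U t c f]
      merge_overlap_remove[OF fin v, of t c f] overlap_nonneg[of "t c v" "t f v"] by linarith
  have "overlap (?s e x) (?s d x) = 0" if "x \<in> ?W" for x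
  proof (cases "x = c")
    case True
    then show ?thesis using ne cd cd0 df by (simp add: merge_def)
  next
    case False
    have "(\<Sum>x\<in>V. overlap (t e x) (t d x)) = 0"
      using arc_overlap[OF e(1) d(1) ed] by (simp add: merge_overlap_def)
    then have "overlap (t e x) (t d x) = 0"
      using that fin overlap_nonneg by (subst (asm) sum_nonneg_eq_0_iff) auto
    with False show ?thesis using ne cd by (simp add: merge_def)
  qed
  then have K2: "merge_overlap ?W ?s e d = 0"
    by (simp add: merge_overlap_def)
  have sed: "?s e d = 1"
    using ed ne cd by (simp add: merge_def)
  have deg: "tdeg V t u = 4" if "u \<in> V" for u
    using costs[OF that] by (simp add: tdeg_eq)
  have degU: "tdeg ?U t u = 4 - \<bar>t u v\<bar>" if "u \<in> V" for u
    using tdeg_remove[OF fin v] deg[OF that] by simp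
  have degW: "tdeg ?W ?s u \<le> 5" "u \<noteq> c \<Longrightarrow> tdeg ?W ?s u \<le> 4 - \<bar>t u v\<bar>" if "u \<in> ?W" for u
  proof -
    have 1: "tdeg ?W ?s u \<le> 4 - \<bar>t u v\<bar>" if "u \<noteq> c"
      using tdeg_merge_other[OF U that, of t] degU[of u] \<open>u \<in> ?W\<close> by simp
    then show "u \<noteq> c \<Longrightarrow> tdeg ?W ?s u \<le> 4 - \<bar>t u v\<bar>" .
    have "tdeg ?W ?s c \<le> 5"
      using tdeg_merge[OF U antisym] degU[OF c(1)] degU[OF f(1)] K1 f inv by simp
    with 1 show "tdeg ?W ?s u \<le> 5" by (cases "u = c") auto
  qed
  have "orderable (?W - {d}) ?s' 0"
  proof (rule minimal)
    show "card (?W - {d}) < card V"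
      using v by (intro psubset_card_mono fin) auto
    show "finite (?W - {d})" using fin by simp
    show "?s' x y = - ?s' y x" for x y by (rule anti')
    fix u assume u: "u \<in> ?W - {d}"
    show "tdeg (?W - {d}) ?s' u \<le> 5"
    proof (cases "u = e")
      case True
      have "tdeg ?W ?s e \<le> 4" "tdeg ?W ?s d \<le> 3"
        using degW(2)[OF W(2)] degW(2)[OF W(3)] ne cd inv by auto
      with True tdeg_merge[OF W anti] K2 sed show ?thesis by simp
    next
      case False
      with tdeg_merge_other[OF W, of u ?s] degW(1)[of u] u show ?thesis by auto
    qed
  qed
  from orderable_merge[OF W anti this] have "orderable ?W ?s (- 1)"
    using K2 sed by simp
  from orderable_merge[OF U antisym this] have "orderable ?U t (- 2)"
    using K1 f by simp
  from orderable_place_first[OF fin v t_self this] show False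
    using not_orderable costs[OF v] by simp
qed

end

theorem orderable_if_tdeg_le_5:
  assumes "finite V" "\<And>x y. t x y = - t y x" "\<And>v. v \<in> V \<Longrightarrow> tdeg V t v \<le> 5"
  shows "orderable V t 0"
  using assms
proof (induction "card V" arbitrary: V t rule: less_induct)
  case less
  show ?case
  proof (rule ccontr)
    assume "\<not> orderable V t 0"
    then have "minimal_counterexample V t"
      using less.prems by (intro minimal_counterexample.intro less.hyps)
    then show False
      by (rule minimal_counterexample.inconsistent)
  qed
qed

section \<open>Feedback arc sets from orderings\<close>

definition arc_count :: "('a, 'b) pre_digraph \<Rightarrow> 'a \<Rightarrow> 'a \<Rightarrow> int" where
  "arc_count G u v = (\<Sum>e\<in>arcs G. of_bool (tail G e = u \<and> head G e = v))"

definition net_arcs :: "('a, 'b) pre_digraph \<Rightarrow> 'a \<Rightarrow> 'a \<Rightarrow> int" where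
  "net_arcs G u v = arc_count G u v - arc_count G v u"

lemma arc_count_nonneg: "arc_count G u v \<ge> 0"
  unfolding arc_count_def by (intro sum_nonneg) simp

text \<open>Each arc is counted only at its own pair of ends. Suitable choices of \<open>P\<close>
  give out-degrees, in-degrees, forward arcs and backward arcs.\<close>

lemma (in fin_digraph) sum_arc_count:
  "(\<Sum>u\<in>verts G. \<Sum>v\<in>verts G. if P u v then arc_count G u v else 0) =
    int (card {e \<in> arcs G. P (tail G e) (head G e)})"
proof -
  have "(\<Sum>u\<in>verts G. \<Sum>v\<in>verts G. if P u v then arc_count G u v else 0) =
      (\<Sum>u\<in>verts G. \<Sum>v\<in>verts G. \<Sum>e\<in>arcs G.
        if tail G e = u then if head G e = v then of_bool (P u v) else 0 else 0)"
    unfolding arc_count_def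
    by (intro sum.cong refl) (auto intro!: sum.cong sum.neutral simp del: sum_of_bool_eq)
  also have "\<dots> = (\<Sum>e\<in>arcs G. \<Sum>u\<in>verts G. \<Sum>v\<in>verts G.
        if tail G e = u then if head G e = v then of_bool (P u v) else 0 else 0)"
    by (subst (2) sum.swap, subst sum.swap) simp
  also have "\<dots> = (\<Sum>e\<in>arcs G. \<Sum>u\<in>verts G.
        if tail G e = u then of_bool (P u (head G e)) else 0)"
    by (intro sum.cong) auto
  also have "\<dots> = (\<Sum>e\<in>arcs G. of_bool (P (tail G e) (head G e)))"
    by (intro sum.cong) auto
  also have "\<dots> = int (card {e \<in> arcs G. P (tail G e) (head G e)})"
    by (simp add: Int_def)
  finally show ?thesis .
qed

lemma (in fin_digraph) sum_arc_count_out: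
  assumes "v \<in> verts G"
  shows "(\<Sum>u\<in>verts G. arc_count G v u) = int (out_degree G v)"
proof -
  have "(\<Sum>u\<in>verts G. arc_count G v u) =
      (\<Sum>w\<in>verts G. if w = v then \<Sum>u\<in>verts G. arc_count G w u else 0)"
    using assms by simp
  also have "\<dots> = (\<Sum>w\<in>verts G. \<Sum>u\<in>verts G. if w = v then arc_count G w u else 0)"
    by (intro sum.cong) auto
  also have "\<dots> = int (card {e \<in> arcs G. tail G e = v})"
    by (rule sum_arc_count)
  finally show ?thesis
    by (simp add: out_degree_def out_arcs_def)
qed

lemma (in fin_digraph) sum_arc_count_in:
  assumes "v \<in> verts G"
  shows "(\<Sum>u\<in>verts G. arc_count G u v) = int (in_degree G v)"
proof -
  have "(\<Sum>u\<in>verts G. arc_count G u v) =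
      (\<Sum>u\<in>verts G. \<Sum>w\<in>verts G. if w = v then arc_count G u w else 0)"
    using assms by simp
  also have "\<dots> = int (card {e \<in> arcs G. head G e = v})"
    by (rule sum_arc_count)
  finally show ?thesis
    by (simp add: in_degree_def in_arcs_def)
qed

lemma (in fin_digraph) tdeg_net_arcs_le:
  assumes "v \<in> verts G"
  shows "tdeg (verts G) (net_arcs G) v \<le> int (degree G v)"
proof -
  have "tdeg (verts G) (net_arcs G) v \<le>
      (\<Sum>u\<in>verts G. arc_count G v u + arc_count G u v)"
    unfolding tdeg_def net_arcs_def
  proof (intro sum_mono)
    show "\<bar>arc_count G v u - arc_count G u v\<bar> \<le>
        arc_count G v u + arc_count G u v" for u
      using arc_count_nonneg[of G v u] arc_count_nonneg[of G u v] by linarith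
  qed
  then show ?thesis
    using assms
    by (simp add: sum.distrib sum_arc_count_out sum_arc_count_in degree_def)
qed

text \<open>This makes net weights record all arcs; with opposite arcs, their penalty would
  understate twice the backward minus the forward arcs.\<close>

lemma (in oriented_multigraph) arc_count_opposite:
  "arc_count G u v = 0 \<or> arc_count G v u = 0"
proof -
  have "\<exists>e\<in>arcs G. tail G e = x \<and> head G e = y" if "arc_count G x y \<noteq> 0" for x y
    using that by (auto simp: arc_count_def)
  then show ?thesis using no_opposite_arcs by metis
qed

lemma (in oriented_multigraph) excess_backward_arcs:
  assumes "inj_on r (verts G)"
  shows "3 * int (card {e \<in> arcs G. r (head G e) < r (tail G e)}) \<le>
    int (card (arcs G)) + excess (verts G) (net_arcs G) r"
proof -
  let ?B = "{e \<in> arcs G. r (head G e) < r (tail G e)}"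
  let ?F = "{e \<in> arcs G. r (tail G e) < r (head G e)}"
  have "r (tail G e) \<noteq> r (head G e)" if "e \<in> arcs G" for e
    using assms that no_loops[OF that] by (auto dest: inj_onD)
  then have "arcs G = ?B \<union> ?F" by force
  then have "card (arcs G) = card (?B \<union> ?F)" by simp
  also have "\<dots> = card ?B + card ?F"
    by (intro card_Un_disjoint) auto
  finally have m: "card (arcs G) = card ?B + card ?F" .
  have pen: "penalty (net_arcs G u v) \<ge> 2 * arc_count G v u - arc_count G u v" for u v
    using arc_count_opposite[of u v] arc_count_nonneg[of G u v]
      arc_count_nonneg[of G v u]
    by (auto simp: penalty_def net_arcs_def)
  have "2 * int (card ?B) - int (card ?F) =
      2 * (\<Sum>u\<in>verts G. \<Sum>v\<in>verts G. if r v < r u then arc_count G u v else 0) -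
      (\<Sum>u\<in>verts G. \<Sum>v\<in>verts G. if r u < r v then arc_count G u v else 0)"
    by (simp add: sum_arc_count)
  \<comment> \<open>Swapping the indices charges backward arcs, like forward ones, to the pair with
    \<open>u\<close> before \<open>v\<close>.\<close>
  also have "(\<Sum>u\<in>verts G. \<Sum>v\<in>verts G. if r v < r u then arc_count G u v else 0) =
      (\<Sum>u\<in>verts G. \<Sum>v\<in>verts G. if r u < r v then arc_count G v u else 0)"
    by (rule sum.swap)
  also have "2 * \<dots> - (\<Sum>u\<in>verts G. \<Sum>v\<in>verts G. if r u < r v then arc_count G u v else 0) =
      (\<Sum>u\<in>verts G. \<Sum>v\<in>verts G.
        if r u < r v then 2 * arc_count G v u - arc_count G u v else 0)"
    unfolding sum_distrib_left sum_subtractf[symmetric] by (intro sum.cong) auto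
  also have "\<dots> \<le> excess (verts G) (net_arcs G) r"
    unfolding excess_def using pen by (intro sum_mono) auto
  finally show ?thesis using m by simp
qed

text \<open>Ranks strictly increase along the remaining arcs, so no nonempty walk can close.\<close>

lemma (in fin_digraph) feedback_arc_set_backward_arcs:
  fixes r :: "'a \<Rightarrow> int"
  assumes "\<And>e. e \<in> arcs G \<Longrightarrow> r (tail G e) \<noteq> r (head G e)"
  shows "feedback_arc_set G {e \<in> arcs G. r (head G e) < r (tail G e)}"
    (is "feedback_arc_set G ?B")
proof -
  define H where "H = del_arcs G ?B"
  interpret H: pre_digraph H .
  have H: "arcs H = arcs G - ?B" "tail H = tail G" "head H = head G"
    by (simp_all add: H_def del_arcs_def)
  have mono: "r u \<le> r v \<and> (p \<noteq> [] \<longrightarrow> r u < r v)"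
    if "H.cas u p v" "set p \<subseteq> arcs G - ?B" for u p v
    using that
  proof (induction p arbitrary: u)
    case Nil
    then show ?case by (simp add: H.cas.simps)
  next
    case (Cons e p)
    then have "e \<in> arcs G" "\<not> r (head G e) < r (tail G e)" "tail G e = u" "H.cas (head G e) p v"
      by (auto simp: H.cas.simps H)
    with Cons.IH[of "head G e"] Cons.prems(2) assms[of e] show ?case by auto
  qed
  have "\<not> H.cycle p" for p
  proof
    assume "H.cycle p"
    then obtain u where "H.awalk u p u" "p \<noteq> []"
      by (auto simp: H.cycle_def)
    then show False
      using mono[of u p u] by (auto simp: H.awalk_def H)
  qed
  then show ?thesis
    by (auto simp: feedback_arc_set_def H_def)
qed

theorem theorem2:
  fixes D :: "('a, 'b) pre_digraph" and m :: nat
  assumes "oriented_multigraph D"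
    and "m = card (arcs D)"
    and "max_degree D \<le> 5"
  shows "real (fas D) \<le> real m / 3"
proof -
  interpret oriented_multigraph D by (rule assms(1))
  have "tdeg (verts D) (net_arcs D) v \<le> 5" if "v \<in> verts D" for v
    using tdeg_net_arcs_le[OF that] assms(3) that by (force simp: max_degree_le_iff)
  then have "orderable (verts D) (net_arcs D) 0"
    by (intro orderable_if_tdeg_le_5) (auto simp: net_arcs_def)
  then obtain r where r: "inj_on r (verts D)" "excess (verts D) (net_arcs D) r \<le> 0"
    by (auto simp: orderable_def)
  let ?B = "{e \<in> arcs D. r (head D e) < r (tail D e)}"
  have "r (tail D e) \<noteq> r (head D e)" if "e \<in> arcs D" for e
    using r(1) that no_loops[OF that] by (auto dest: inj_onD)
  then have "fas D \<le> card ?B"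
    by (intro fas_le feedback_arc_set_backward_arcs)
  moreover have "3 * card ?B \<le> m"
    using excess_backward_arcs[OF r(1)] r(2) assms(2) by linarith
  ultimately show ?thesis by linarith
qed

end
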